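(* Let $0<a<1$ and $0<b<1$, and let $$f(x)=\begin{cases}-bx, & -1\le x<0,\\ -ax, & 0\le x\le 1.\end{cases}$$ Let $\{X_n^\varepsilon\}_{n\ge 0}$ be the process defined by $X_0^\varepsilon=0$ and $X_{n+1}^\varepsilon=f(X_n^\varepsilon)+\varepsilon\xi_{n+1}$, and let $\tau=\min\{n\ge 1:|X_n^\varepsilon|\ge 1\}$. Then $$\limsup_{\varepsilon\to 0}\varepsilon^2\log E\tau\le\frac12\min\left(\frac{1-(ab)^2}{1+a^2},\frac{1-(ab)^2}{1+b^2}\right).$$
   Context: Here $\varepsilon>0$ is a small parameter tending to $0$ and $\{\xi_n\}_{n\ge 1}$ is an i.i.d. sequence of standard normal random variables. The function $f$ is specified on $[-1,1]$ and may be extended to a continuous function on $\mathbb{R}$ arbitrarily; only its values on $[-1,1]$ affect the exit time $\tau$. *)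

theory Defs
  imports "HOL-Probability.Probability"
begin

definition iid_std_normal :: "'a measure \<Rightarrow> (nat \<Rightarrow> 'a \<Rightarrow> real) \<Rightarrow> bool" where
  "iid_std_normal M \<xi> \<longleftrightarrow>
     prob_space.indep_vars M (\<lambda>_. borel) \<xi> {1..} \<and>
     (\<forall>n\<ge>1. distributed M lborel (\<xi> n) std_normal_density)"

primrec noisy_orbit ::
  "(real \<Rightarrow> real) \<Rightarrow> (nat \<Rightarrow> 'a \<Rightarrow> real) \<Rightarrow> real \<Rightarrow> nat \<Rightarrow> 'a \<Rightarrow> real" where
  "noisy_orbit f \<xi> \<epsilon> 0 \<omega> = 0"
| "noisy_orbit f \<xi> \<epsilon> (Suc n) \<omega> = f (noisy_orbit f \<xi> \<epsilon> n \<omega>) + \<epsilon> * \<xi> (Suc n) \<omega>"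

(* The infimum is a minimum unless the orbit never leaves (-1, 1), when it is \<infinity>. *)
definition exit_time ::
  "(real \<Rightarrow> real) \<Rightarrow> (nat \<Rightarrow> 'a \<Rightarrow> real) \<Rightarrow> real \<Rightarrow> 'a \<Rightarrow> enat" where
  "exit_time f \<xi> \<epsilon> \<omega> = Inf (enat ` {n. 1 \<le> n \<and> 1 \<le> \<bar>noisy_orbit f \<xi> \<epsilon> n \<omega>\<bar>})"

definition expected_exit_time ::
  "'a measure \<Rightarrow> (real \<Rightarrow> real) \<Rightarrow> (nat \<Rightarrow> 'a \<Rightarrow> real) \<Rightarrow> real \<Rightarrow> ennreal" where
  "expected_exit_time M f \<xi> \<epsilon> = (\<integral>\<^sup>+\<omega>. ennreal_of_enat (exit_time f \<xi> \<epsilon> \<omega>) \<partial>M)"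

(* Extended logarithm: an infinite expectation has logarithm \<infinity>, so an upper bound on it
   is not satisfied vacuously. *)
definition ln_ext :: "ennreal \<Rightarrow> ereal" where
  "ln_ext x = (if x = \<infinity> then \<infinity> else if x = 0 then -\<infinity> else ereal (ln (enn2real x)))"

end

theory Submission
  imports Defs
begin

text \<open>
  The cheapest exit through 1 alternates in sign: in \<open>N\<close> steps it costs
  \<open>1 / (2 S)\<close> with \<open>S = 1 + b\<^sup>2 + (a b)\<^sup>2 + (a b\<^sup>2)\<^sup>2 + \<dots>\<close> (\<open>N\<close> terms), which tends to
  \<open>(1 - (a b)\<^sup>2) / (2 (1 + b\<^sup>2))\<close>. A point of \<open>[0, 1)\<close> follows this path, or runs ahead of it, whenever
  the next \<open>N\<close> noises satisfy fixed one-sided bounds; a point of \<open>(-1, 0)\<close> first moves to the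
  nonnegative side if the next noise is nonnegative. These noise events do not depend on the current
  position, so they are independent of the past, and within every \<open>N + 1\<close> steps the orbit leaves
  \<open>(-1, 1)\<close> with a conditional probability at least \<open>p\<close>, where \<open>- \<epsilon>\<^sup>2 ln p \<longrightarrow> 1 / (2 S)\<close>. Hence the
  expected exit time is at most \<open>(N + 1) / p\<close>. Reflecting space and noise swaps \<open>a\<close> and \<open>b\<close>, which
  gives the other term of the minimum.
\<close>

section \<open>Gaussian tails and independence of past and future noise\<close>

text \<open>On the unit interval between \<open>t\<close> and \<open>t + 1\<close> the density is at
  least its value at the outer end. The shift by 1 disappears later, after scaling by the square of
  \<epsilon>. The sign \<open>s\<close> covers both tails.\<close>

lemma (in prob_space) std_normal_tail_ge:
  assumes X: "distributed M lborel X std_normal_density"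
    and t: "0 \<le> t" and s: "\<bar>s\<bar> = (1::real)"
  shows "std_normal_density (t + 1) \<le> prob {\<omega> \<in> space M. t \<le> s * X \<omega>}"
proof -
  define A where "A = {z. t \<le> s * z \<and> s * z \<le> t + 1}"
  have s': "s = 1 \<or> s = -1" using s by linarith
  have A_eq: "A = {t..t+1} \<or> A = {-(t+1)..-t}"
    using s' unfolding A_def by auto
  have A: "A \<in> sets borel" "emeasure lborel A = 1"
    using A_eq by auto
  have X_meas[measurable]: "X \<in> borel_measurable M"
    using X by (simp add: distributed_def)
  have sets: "{\<omega> \<in> space M. t \<le> s * X \<omega>} \<in> sets M" by measurable
  have "ennreal (std_normal_density (t + 1))
      = (\<integral>\<^sup>+x. ennreal (std_normal_density (t + 1)) * indicator A x \<partial>lborel)"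
    using A by (simp add: nn_integral_cmult_indicator)
  also have "\<dots> \<le> (\<integral>\<^sup>+x. ennreal (std_normal_density x) * indicator A x \<partial>lborel)"
  proof (intro nn_integral_mono)
    fix x :: real
    show "ennreal (std_normal_density (t + 1)) * indicator A x
        \<le> ennreal (std_normal_density x) * indicator A x"
    proof (cases "x \<in> A")
      case True
      then have "\<bar>x\<bar> \<le> \<bar>t + 1\<bar>" using s' t by (auto simp: A_def)
      then have "x\<^sup>2 \<le> (t + 1)\<^sup>2" by (simp only: abs_le_square_iff)
      then have "std_normal_density (t + 1) \<le> std_normal_density x"
        by (auto simp: std_normal_density_def intro!: divide_right_mono)
      then show ?thesis using True by (simp add: ennreal_leI)
    qed simp
  qed
  also have "\<dots> = emeasure M (X -` A \<inter> space M)"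
    using distributed_emeasure[OF X, of A] A by simp
  also have "\<dots> \<le> emeasure M {\<omega> \<in> space M. t \<le> s * X \<omega>}"
    by (intro emeasure_mono sets) (auto simp: A_def)
  finally show ?thesis
    by (simp add: emeasure_eq_measure)
qed

text \<open>The two noise blocks have disjoint indices, so probabilities multiply. The future is
  counted backwards from \<open>n + m\<close>, to match weights indexed by the steps left before the
  exit.\<close>

lemma (in prob_space) prob_past_and_future:
  fixes \<xi> :: "nat \<Rightarrow> 'a \<Rightarrow> real"
  assumes iid: "iid_std_normal M \<xi>"
    and A: "A \<in> sets (Pi\<^sub>M {1..n} (\<lambda>_. borel))"
    and t: "\<And>j. 0 \<le> t j"
    and m: "0 < m"
  shows "prob {\<omega> \<in> space M. (\<lambda>i\<in>{1..n}. \<xi> i \<omega>) \<in> A} * (\<Prod>j<m. std_normal_density (t j + 1))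
    \<le> prob {\<omega> \<in> space M. (\<lambda>i\<in>{1..n}. \<xi> i \<omega>) \<in> A \<and>
              (\<forall>j<m. t j \<le> (-1) ^ j * \<xi> (n + m - j) \<omega>)}"
proof -
  have ind: "indep_vars (\<lambda>_. borel) \<xi> {1..}"
    and dist: "\<And>i. 1 \<le> i \<Longrightarrow> distributed M lborel (\<xi> i) std_normal_density"
    using iid by (auto simp: iid_std_normal_def)
  define J where "J = {n<..n + m}"
  define S where "S i = {z::real. t (n + m - i) \<le> (-1) ^ (n + m - i) * z}" for i
  have S: "S i \<in> sets borel" for i unfolding S_def by measurable
  have J: "J \<noteq> {}" "finite J" "J \<subseteq> {1..}" using m by (auto simp: J_def)
  have B: "Pi\<^sub>E J S \<in> sets (Pi\<^sub>M J (\<lambda>_. borel))"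
    using J S by (intro sets_PiM_I_finite) auto
  have fut: "(\<lambda>i\<in>J. \<xi> i \<omega>) \<in> Pi\<^sub>E J S \<longleftrightarrow> (\<forall>j<m. t j \<le> (-1) ^ j * \<xi> (n + m - j) \<omega>)" for \<omega>
  proof -
    have "(\<lambda>i\<in>J. \<xi> i \<omega>) \<in> Pi\<^sub>E J S \<longleftrightarrow> (\<forall>i\<in>J. \<xi> i \<omega> \<in> S i)"
      by (auto simp: PiE_iff)
    also have "\<dots> \<longleftrightarrow> (\<forall>i\<in>(\<lambda>j. n + m - j) ` {..<m}. \<xi> i \<omega> \<in> S i)"
    proof -
      have "i \<in> (\<lambda>j. n + m - j) ` {..<m}" if "i \<in> J" for i
        using that by (intro image_eqI[of _ _ "n + m - i"]) (auto simp: J_def)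
      then have "J = (\<lambda>j. n + m - j) ` {..<m}" by (auto simp: J_def)
      then show ?thesis by simp
    qed
    finally show ?thesis by (auto simp: S_def)
  qed
  have "(\<Prod>j<m. std_normal_density (t j + 1))
      = (\<Prod>i\<in>J. std_normal_density (t (n + m - i) + 1))"
    by (rule prod.reindex_bij_witness[of _ "\<lambda>i. n + m - i" "\<lambda>j. n + m - j"])
      (auto simp: J_def)
  also have "\<dots> \<le> (\<Prod>i\<in>J. prob (\<xi> i -` S i \<inter> space M))"
  proof (intro prod_mono conjI)
    fix i assume "i \<in> J"
    then have "distributed M lborel (\<xi> i) std_normal_density" using J by (intro dist) auto
    from std_normal_tail_ge[OF this t, of "(-1) ^ (n + m - i)" "n + m - i"]
    show "std_normal_density (t (n + m - i) + 1) \<le> prob (\<xi> i -` S i \<inter> space M)"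
      by (simp add: S_def vimage_def Int_def conj_commute)
  qed simp
  also have "\<dots> = prob (\<Inter>i\<in>J. \<xi> i -` S i \<inter> space M)"
    using indep_varsD[OF ind J, of S] S by simp
  also have "(\<Inter>i\<in>J. \<xi> i -` S i \<inter> space M) = (\<lambda>\<omega>. \<lambda>i\<in>J. \<xi> i \<omega>) -` Pi\<^sub>E J S \<inter> space M"
    using J by (auto simp: PiE_iff)
  finally have "prob {\<omega> \<in> space M. (\<lambda>i\<in>{1..n}. \<xi> i \<omega>) \<in> A} * (\<Prod>j<m. std_normal_density (t j + 1))
    \<le> prob ((\<lambda>\<omega>. \<lambda>i\<in>{1..n}. \<xi> i \<omega>) -` A \<inter> space M) * prob ((\<lambda>\<omega>. \<lambda>i\<in>J. \<xi> i \<omega>) -` Pi\<^sub>E J S \<inter> space M)"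
    by (auto simp: vimage_def Int_def conj_commute intro!: mult_left_mono)
  also have "\<dots> = prob ((\<lambda>\<omega>. (\<lambda>i\<in>{1..n}. \<xi> i \<omega>, \<lambda>i\<in>J. \<xi> i \<omega>)) -` (A \<times> Pi\<^sub>E J S) \<inter> space M)"
    by (rule indep_varD[OF indep_var_restrict[OF ind] A B, symmetric]) (auto simp: J_def)
  also have "(\<lambda>\<omega>. (\<lambda>i\<in>{1..n}. \<xi> i \<omega>, \<lambda>i\<in>J. \<xi> i \<omega>)) -` (A \<times> Pi\<^sub>E J S) \<inter> space M
     = {\<omega> \<in> space M. (\<lambda>i\<in>{1..n}. \<xi> i \<omega>) \<in> A \<and>
              (\<forall>j<m. t j \<le> (-1) ^ j * \<xi> (n + m - j) \<omega>)}"
    unfolding fut[symmetric] by auto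
  finally show ?thesis .
qed

section \<open>The deterministic escape path\<close>

text \<open>Both slopes are parameters, so that the map reflected through 0 satisfies the same
  predicate with \<open>a\<close> and \<open>b\<close> swapped.\<close>

definition skew_tent :: "real \<Rightarrow> real \<Rightarrow> (real \<Rightarrow> real) \<Rightarrow> bool" where
  "skew_tent a b f \<longleftrightarrow>
     (\<forall>x. -1 \<le> x \<and> x < 0 \<longrightarrow> f x = - b * x) \<and> (\<forall>x. 0 \<le> x \<and> x \<le> 1 \<longrightarrow> f x = - a * x)"

text \<open>Indexed by the number of steps left before an exit through 1: the last point before the
  exit is negative (slope \<open>-b\<close>), the one before it positive (slope \<open>-a\<close>), and so on.\<close>
definition path_weight :: "real \<Rightarrow> real \<Rightarrow> nat \<Rightarrow> real" where
  "path_weight a b j = (\<Prod>i<j. if even i then b else a)"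

definition path_energy :: "real \<Rightarrow> real \<Rightarrow> nat \<Rightarrow> real" where
  "path_energy a b N = (\<Sum>j<N. (path_weight a b j)\<^sup>2)"

lemma path_weight_Suc: "path_weight a b (Suc j) = path_weight a b j * (if even j then b else a)"
  by (simp add: path_weight_def)

lemma path_weight_pos: "0 < a \<Longrightarrow> 0 < b \<Longrightarrow> 0 < path_weight a b j"
  by (auto simp: path_weight_def intro!: prod_pos)

lemma path_energy_pos: "0 < a \<Longrightarrow> 0 < b \<Longrightarrow> 0 < N \<Longrightarrow> 0 < path_energy a b N"
  by (auto simp: path_energy_def intro!: sum_pos path_weight_pos zero_less_power)

lemma path_weight_even: "path_weight a b (2 * k) = (a * b) ^ k"
  by (induction k) (auto simp: path_weight_def)

text \<open>A geometric sum with ratio \<open>(a * b)\<^sup>2\<close>: each pair of steps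
  contributes the factor \<open>1 + b\<^sup>2\<close>.\<close>

lemma path_energy_even:
  "(1 - (a * b)\<^sup>2) * path_energy a b (2 * k) = (1 + b\<^sup>2) * (1 - (a * b) ^ (2 * k))"
proof (induction k)
  case (Suc k)
  have "(path_weight a b (2 * k))\<^sup>2 = (a * b) ^ (2 * k)"
    unfolding path_weight_even power_mult[symmetric] by (simp only: mult.commute)
  then have "path_energy a b (2 * Suc k) = path_energy a b (2 * k) + (a * b) ^ (2 * k) * (1 + b\<^sup>2)"
    by (simp add: path_energy_def path_weight_Suc power_mult_distrib distrib_left)
  then have "(1 - (a * b)\<^sup>2) * path_energy a b (2 * Suc k)
      = (1 - (a * b)\<^sup>2) * path_energy a b (2 * k) + (1 - (a * b)\<^sup>2) * ((a * b) ^ (2 * k) * (1 + b\<^sup>2))"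
    by (simp only: distrib_left)
  also have "\<dots> = (1 + b\<^sup>2) * (1 - (a * b)\<^sup>2 * (a * b) ^ (2 * k))"
    unfolding Suc.IH by algebra
  also have "(a * b)\<^sup>2 * (a * b) ^ (2 * k) = (a * b) ^ (2 * Suc k)"
    unfolding power_add[symmetric] by simp
  finally show ?case .
qed (simp add: path_energy_def)

text \<open>The noise pushes the orbit across the kink in alternating directions. Only one-sided bounds
  are needed: an orbit point further from 0 than planned is mapped further from 0, on the other
  side, and so stays ahead of the planned path.\<close>
lemma skew_tent_escape:
  assumes f: "skew_tent a b f" and ab: "0 < a" "0 < b"
    and N: "0 < N" "even N"
    and x: "\<And>i. x (Suc i) = f (x i) + e (Suc i)" "0 \<le> x 0"
    and e: "\<And>j. j < N \<Longrightarrow> path_weight a b j / path_energy a b N \<le> (-1) ^ j * e (N - j)"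
  shows "\<exists>i\<le>N. 1 \<le> \<bar>x i\<bar>"
proof (rule ccontr)
  assume "\<not> ?thesis"
  then have small: "\<bar>x i\<bar> < 1" if "i \<le> N" for i using that by force
  note wpos = path_weight_pos[OF ab]
  have Spos: "0 < path_energy a b N" using path_energy_pos ab N by auto
  \<comment> \<open>distance from 0 planned for \<open>j\<close> steps before the exit\<close>
  define r where "r j = (\<Sum>i\<in>{j..<N}. (path_weight a b i)\<^sup>2) / (path_weight a b j * path_energy a b N)" for j
  have r_nonneg: "0 \<le> r j" for j
    unfolding r_def using wpos[of j] Spos by (auto intro!: divide_nonneg_nonneg sum_nonneg)
  \<comment> \<open>The weight at \<open>Suc j\<close> is the weight at \<open>j\<close> times the
    slope, so the slope cancels and the noise supplies exactly term \<open>j\<close> of the energy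
    sum.\<close>
  have r_step: "r j = (if even j then b else a) * r (Suc j) + path_weight a b j / path_energy a b N"
    if "j < N" for j
  proof -
    have "(\<Sum>i\<in>{j..<N}. (path_weight a b i)\<^sup>2)
        = (path_weight a b j)\<^sup>2 + (\<Sum>i\<in>{Suc j..<N}. (path_weight a b i)\<^sup>2)"
      using that by (simp add: sum.atLeast_Suc_lessThan)
    then show ?thesis
      unfolding r_def path_weight_Suc using wpos[of j] Spos ab
      by (simp add: field_simps power2_eq_square)
  qed
  \<comment> \<open>Descending in \<open>j\<close> follows the orbit forward in time, from planned
    distance 0 at the start to 1 at the exit. As \<open>N\<close> is even, the sign at the start is
    positive.\<close>
  have "r j \<le> (-1) ^ j * x (N - j)" if "j \<le> N" for j
    using that
  proof (induction j rule: inc_induct)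
    case base
    then show ?case using N x by (simp add: r_def)
  next
    case (step j)
    define y where "y = x (N - Suc j)"
    have le: "N - Suc j \<le> N" by simp
    have y: "\<bar>y\<bar> < 1" unfolding y_def by (rule small[OF le])
    have ge: "r (Suc j) \<le> (-1) ^ Suc j * y" using step by (simp add: y_def)
    have "(-1) ^ j * f y = (if even j then b else a) * ((-1) ^ Suc j * y)"
    proof (cases "even j")
      case True
      then have "y \<le> 0" using ge r_nonneg[of "Suc j"] by simp
      \<comment> \<open>At \<open>y = 0\<close> the other branch of the map applies, with the same
        value 0.\<close>
      then have "f y = - b * y" using f y by (cases "y = 0") (auto simp: skew_tent_def)
      then show ?thesis using True by simp
    next
      case False
      then have "0 \<le> y" using ge r_nonneg[of "Suc j"] by simp
      then have "f y = - a * y" using f y by (auto simp: skew_tent_def)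
      then show ?thesis using False by simp
    qed
    moreover have "(if even j then b else a) * r (Suc j) \<le> (if even j then b else a) * ((-1) ^ Suc j * y)"
      using ge ab by (intro mult_left_mono) auto
    moreover have "x (N - j) = f y + e (N - j)"
      using x(1)[of "N - Suc j"] step by (simp add: y_def Suc_diff_Suc)
    ultimately show ?case
      using r_step[of j] e[of j] step by (simp add: distrib_left)
  qed
  from this[of 0] have "r 0 \<le> x N" by simp
  moreover have "r 0 = 1"
    using Spos by (simp add: r_def path_weight_def path_energy_def atLeast0LessThan)
  ultimately show False using small[of N] by simp
qed

section \<open>Survival up to a given time and the exit time\<close>

text \<open>Makes the orbit up to time \<open>n\<close> a function of the noise vector on
  \<open>{1..n}\<close>, the form in which past events enter
  \<open>prob_past_and_future\<close>.\<close>

lemma noisy_orbit_restrict: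
  "k \<le> n \<Longrightarrow>
    noisy_orbit f (\<lambda>i v. v i) \<epsilon> k (\<lambda>i\<in>{1..n}. \<xi> i \<omega>) = noisy_orbit f \<xi> \<epsilon> k \<omega>"
  by (induction k) auto

lemma measurable_noisy_orbit:
  assumes f: "f \<in> borel_measurable borel"
    and \<xi>: "\<And>i. 1 \<le> i \<Longrightarrow> i \<le> k \<Longrightarrow> \<xi> i \<in> borel_measurable N"
  shows "noisy_orbit f \<xi> \<epsilon> k \<in> borel_measurable N"
  using \<xi>
proof (induction k)
  case (Suc k)
  have [measurable]: "noisy_orbit f \<xi> \<epsilon> k \<in> borel_measurable N" "\<xi> (Suc k) \<in> borel_measurable N"
    using Suc by auto
  note f[measurable]
  show ?case by simp
next
  case 0
  have "noisy_orbit f \<xi> \<epsilon> 0 = (\<lambda>_. 0)" by (simp add: fun_eq_iff)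
  then show ?case by simp
qed

definition survives ::
  "(real \<Rightarrow> real) \<Rightarrow> (nat \<Rightarrow> 'a \<Rightarrow> real) \<Rightarrow> real \<Rightarrow> nat \<Rightarrow> 'a \<Rightarrow> bool" where
  "survives f \<xi> \<epsilon> n \<omega> \<longleftrightarrow> (\<forall>k\<in>{1..n}. \<bar>noisy_orbit f \<xi> \<epsilon> k \<omega>\<bar> < 1)"

lemma survives_restrict:
  "survives f (\<lambda>i v. v i) \<epsilon> n (\<lambda>i\<in>{1..n}. \<xi> i \<omega>) = survives f \<xi> \<epsilon> n \<omega>"
  by (simp add: survives_def noisy_orbit_restrict del: One_nat_def)

lemma pred_survives:
  assumes f: "f \<in> borel_measurable borel"
    and \<xi>: "\<And>i. 1 \<le> i \<Longrightarrow> i \<le> n \<Longrightarrow> \<xi> i \<in> borel_measurable N"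
  shows "Measurable.pred N (survives f \<xi> \<epsilon> n)"
proof -
  have "Measurable.pred N (\<lambda>\<omega>. \<bar>noisy_orbit f \<xi> \<epsilon> k \<omega>\<bar> < 1)" if "k \<in> {1..n}" for k
  proof -
    have [measurable]: "noisy_orbit f \<xi> \<epsilon> k \<in> borel_measurable N"
      using that by (intro measurable_noisy_orbit f \<xi>) auto
    show ?thesis by measurable
  qed
  then show ?thesis
    unfolding survives_def[abs_def] by (intro pred_intros_finite) auto
qed

lemma less_exit_time_iff: "enat n < exit_time f \<xi> \<epsilon> \<omega> \<longleftrightarrow> survives f \<xi> \<epsilon> n \<omega>"
proof
  assume *: "enat n < exit_time f \<xi> \<epsilon> \<omega>"
  have "enat n < enat k" if "1 \<le> k" "1 \<le> \<bar>noisy_orbit f \<xi> \<epsilon> k \<omega>\<bar>" for k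
  proof -
    have "exit_time f \<xi> \<epsilon> \<omega> \<le> enat k"
      unfolding exit_time_def using that by (intro Inf_lower) auto
    with * show ?thesis by (rule less_le_trans)
  qed
  then show "survives f \<xi> \<epsilon> n \<omega>"
    unfolding survives_def by (metis atLeastAtMost_iff enat_ord_simps(2) not_less)
next
  assume *: "survives f \<xi> \<epsilon> n \<omega>"
  have "enat (Suc n) \<le> exit_time f \<xi> \<epsilon> \<omega>"
    unfolding exit_time_def
  proof (rule Inf_greatest, clarify)
    fix k assume "1 \<le> k" "1 \<le> \<bar>noisy_orbit f \<xi> \<epsilon> k \<omega>\<bar>"
    then have "\<not> k \<le> n"
      using * unfolding survives_def by (metis atLeastAtMost_iff not_less)
    then show "enat (Suc n) \<le> enat k" by simp
  qed
  then show "enat n < exit_time f \<xi> \<epsilon> \<omega>"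
    by (simp add: Suc_ile_eq)
qed

text \<open>Each value of the exit time, infinity included, is determined by countably many survival
  events, and \<open>enat\<close> is countable.\<close>

lemma measurable_exit_time:
  assumes "\<And>n. Measurable.pred N (survives f \<xi> \<epsilon> n)"
  shows "exit_time f \<xi> \<epsilon> \<in> measurable N (count_space UNIV)"
proof (subst measurable_count_space_eq2_countable, safe)
  note [measurable] = assms
  fix x :: enat
  have "{\<omega> \<in> space N. exit_time f \<xi> \<epsilon> \<omega> = x} \<in> sets N"
  proof (cases x)
    case (enat n)
    have "exit_time f \<xi> \<epsilon> \<omega> = x \<longleftrightarrow>
        \<not> survives f \<xi> \<epsilon> n \<omega> \<and> (\<forall>k. k < n \<longrightarrow> survives f \<xi> \<epsilon> k \<omega>)" for \<omega>
      unfolding less_exit_time_iff[symmetric] enat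
      by (cases "exit_time f \<xi> \<epsilon> \<omega>") (auto, metis linorder_neqE_nat less_irrefl)
    then show ?thesis by simp
  next
    case infinity
    have "exit_time f \<xi> \<epsilon> \<omega> = x \<longleftrightarrow> (\<forall>k. survives f \<xi> \<epsilon> k \<omega>)" for \<omega>
      unfolding less_exit_time_iff[symmetric] infinity
      by (cases "exit_time f \<xi> \<epsilon> \<omega>") auto
    then show ?thesis by simp
  qed
  then show "exit_time f \<xi> \<epsilon> -` {x} \<inter> space N \<in> sets N"
    by (simp add: vimage_def Int_def conj_commute)
qed auto

section \<open>Decay of the survival probability\<close>

text \<open>Entry \<open>N\<close> is the preliminary step from the negative to the nonnegative side.\<close>
definition escape_noise :: "real \<Rightarrow> real \<Rightarrow> nat \<Rightarrow> real \<Rightarrow> nat \<Rightarrow> real" where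
  "escape_noise a b N \<epsilon> j =
     (if j < N then path_weight a b j / path_energy a b N / \<epsilon> else 0)"

text \<open>A lower bound for the probability that all \<open>Suc N\<close> noise bounds hold; the
  factors, with their shift by 1, come from \<open>std_normal_tail_ge\<close>.\<close>

definition escape_prob :: "real \<Rightarrow> real \<Rightarrow> nat \<Rightarrow> real \<Rightarrow> real" where
  "escape_prob a b N \<epsilon> = (\<Prod>j<Suc N. std_normal_density (escape_noise a b N \<epsilon> j + 1))"

lemma std_normal_density_le_1: "std_normal_density x \<le> 1"
proof -
  have "1 \<le> sqrt (2 * pi)" using pi_ge_two by simp
  moreover have "exp (- x\<^sup>2 / 2) \<le> 1" by simp
  ultimately have "exp (- x\<^sup>2 / 2) \<le> sqrt (2 * pi)" by (rule order_trans[rotated])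
  then show ?thesis
    by (simp add: std_normal_density_def divide_le_eq)
qed

lemma escape_prob_pos: "0 < escape_prob a b N \<epsilon>"
  unfolding escape_prob_def by (intro prod_pos ballI normal_density_pos) auto

text \<open>The surviving mass is split by the side of 0 on which the orbit is. The nonnegative part
  needs \<open>N\<close> noises to escape, the negative part \<open>Suc N\<close>, and each loses at
  least the fraction \<open>escape_prob\<close>.\<close>

lemma (in prob_space) survival_decay:
  assumes iid: "iid_std_normal M \<xi>" and f_meas: "f \<in> borel_measurable borel"
    and f: "skew_tent a b f" and ab: "0 < a" "0 < b"
    and N: "0 < N" "even N" and \<epsilon>: "0 < \<epsilon>"
  shows "prob {\<omega> \<in> space M. survives f \<xi> \<epsilon> (n + Suc N) \<omega>}
    \<le> (1 - escape_prob a b N \<epsilon>) * prob {\<omega> \<in> space M. survives f \<xi> \<epsilon> n \<omega>}"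
proof -
  define t where "t = escape_noise a b N \<epsilon>"
  define X where "X k \<omega> = noisy_orbit f \<xi> \<epsilon> k \<omega>" for k \<omega>
  define V where "V k \<omega> = survives f \<xi> \<epsilon> k \<omega>" for k \<omega>
  define p where "p = escape_prob a b N \<epsilon>"
  have t_nonneg: "0 \<le> t j" for j
    unfolding t_def escape_noise_def
    using path_weight_pos[OF ab, of j] path_energy_pos[OF ab N(1)] \<epsilon> by auto
  have \<xi>_meas: "\<xi> i \<in> borel_measurable M" if "1 \<le> i" for i
    using iid that by (auto simp: iid_std_normal_def distributed_def)
  have [measurable]: "Measurable.pred M (V k)" for k
    unfolding V_def by (intro pred_survives f_meas \<xi>_meas) auto
  have [measurable]: "X k \<in> borel_measurable M" for k
    unfolding X_def by (intro measurable_noisy_orbit f_meas \<xi>_meas) auto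
  let ?P = "Pi\<^sub>M {1..n} (\<lambda>_. borel :: real measure)"
  have [measurable]: "Measurable.pred ?P (survives f (\<lambda>i v. v i) \<epsilon> n)"
    by (intro pred_survives f_meas measurable_component_singleton) auto
  have [measurable]: "noisy_orbit f (\<lambda>i v. v i) \<epsilon> n \<in> borel_measurable ?P"
    by (intro measurable_noisy_orbit f_meas measurable_component_singleton) auto
  \<comment> \<open>\<open>l\<close> is the number of preliminary steps, 0 or 1.\<close>
  have escape: "\<not> V (n + Suc N) \<omega>"
    if l: "l \<le> 1" and pos: "0 \<le> X (n + l) \<omega>"
      and noise: "\<forall>j<N. t j \<le> (-1) ^ j * \<xi> (n + (N + l) - j) \<omega>" for \<omega> l
  proof -
    have "\<exists>i\<le>N. 1 \<le> \<bar>X (n + l + i) \<omega>\<bar>"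
    proof (rule skew_tent_escape[where e = "\<lambda>i. \<epsilon> * \<xi> (n + l + i) \<omega>", OF f ab N])
      fix j assume j: "j < N"
      then have "path_weight a b j / path_energy a b N = \<epsilon> * t j"
        using \<epsilon> by (simp add: t_def escape_noise_def)
      also have "\<dots> \<le> \<epsilon> * ((-1) ^ j * \<xi> (n + (N + l) - j) \<omega>)"
        using noise j \<epsilon> by (intro mult_left_mono) auto
      also have "n + (N + l) - j = n + l + (N - j)" using j by simp
      finally show "path_weight a b j / path_energy a b N
          \<le> (-1) ^ j * (\<epsilon> * \<xi> (n + l + (N - j)) \<omega>)" by (simp add: ac_simps)
    qed (use pos in \<open>simp_all add: X_def\<close>)
    then obtain i where i: "i \<le> N" "1 \<le> \<bar>X (n + l + i) \<omega>\<bar>" by blast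
    \<comment> \<open>At time 0 the orbit is at 0, so the exit found happens at a time that
      \<open>survives\<close> tests.\<close>
    then have "n + l + i \<noteq> 0" by (intro notI) (simp add: X_def)
    then have "n + l + i \<in> {1..n + Suc N}" using i l by auto
    then show ?thesis using i(2) unfolding V_def survives_def X_def by (metis not_less)
  qed
  \<comment> \<open>Dropping the factor of the preliminary step, which is at most 1, only enlarges
    the product.\<close>
  have p_le: "p \<le> (\<Prod>j<N. std_normal_density (t j + 1))"
    unfolding p_def escape_prob_def t_def
    by (auto intro!: mult_left_le prod_nonneg std_normal_density_le_1)
  \<comment> \<open>\<open>Q\<close> stands for the side of 0; together with survival it is decided
    by the first \<open>n\<close> noises.\<close>
  have past: "prob {\<omega> \<in> space M. V n \<omega> \<and> Q (X n \<omega>)} * (\<Prod>j<m. std_normal_density (t j + 1))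
      \<le> prob {\<omega> \<in> space M. (V n \<omega> \<and> Q (X n \<omega>)) \<and>
              (\<forall>j<m. t j \<le> (-1) ^ j * \<xi> (n + m - j) \<omega>)}"
    if m: "0 < m" and Q[measurable]: "Measurable.pred borel Q" for m Q
  proof -
    define A where "A = {v \<in> space ?P. survives f (\<lambda>i v. v i) \<epsilon> n v \<and>
        Q (noisy_orbit f (\<lambda>i v. v i) \<epsilon> n v)}"
    have A: "A \<in> sets ?P" unfolding A_def by measurable
    have eq: "(\<lambda>i\<in>{1..n}. \<xi> i \<omega>) \<in> A \<longleftrightarrow> V n \<omega> \<and> Q (X n \<omega>)" for \<omega>
      by (simp add: A_def V_def X_def survives_restrict noisy_orbit_restrict space_PiM
          del: One_nat_def)
    show ?thesis
      using prob_past_and_future[where t=t, OF iid A t_nonneg m] unfolding eq .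
  qed
  have "prob {\<omega> \<in> space M. V n \<omega> \<and> 0 \<le> X n \<omega>} * p
      \<le> prob {\<omega> \<in> space M. V n \<omega> \<and> 0 \<le> X n \<omega>} * (\<Prod>j<N. std_normal_density (t j + 1))"
    using p_le by (intro mult_left_mono) auto
  also have "\<dots> \<le> prob {\<omega> \<in> space M. (V n \<omega> \<and> 0 \<le> X n \<omega>) \<and>
              (\<forall>j<N. t j \<le> (-1) ^ j * \<xi> (n + N - j) \<omega>)}"
    using N by (intro past) auto
  also have "\<dots> \<le> prob {\<omega> \<in> space M. V n \<omega> \<and> 0 \<le> X n \<omega> \<and> \<not> V (n + Suc N) \<omega>}"
    using escape[of 0] by (intro finite_measure_mono) auto
  finally have pos: "prob {\<omega> \<in> space M. V n \<omega> \<and> 0 \<le> X n \<omega>} * p \<le> \<dots>" .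
  have neg_step: "0 \<le> X (n + 1) \<omega>" if "V n \<omega>" "X n \<omega> < 0" "0 \<le> \<xi> (Suc n) \<omega>" for \<omega>
  proof -
    \<comment> \<open>A negative position excludes time 0, so survival puts \<open>X n\<close> where
      the map is prescribed.\<close>
    have "n \<noteq> 0" using that by (intro notI) (simp add: X_def)
    then have "n \<in> {1..n}" by simp
    then have "\<bar>X n \<omega>\<bar> < 1" using that unfolding V_def survives_def X_def by blast
    then have "f (X n \<omega>) = - b * X n \<omega>" using f that by (auto simp: skew_tent_def)
    moreover have "0 \<le> - b * X n \<omega>" using that ab by (simp add: mult_le_0_iff)
    moreover have "0 \<le> \<epsilon> * \<xi> (Suc n) \<omega>" using that \<epsilon> by simp
    ultimately show ?thesis by (simp add: X_def)
  qed
  have "prob {\<omega> \<in> space M. V n \<omega> \<and> X n \<omega> < 0} * p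
     \<le> prob {\<omega> \<in> space M. (V n \<omega> \<and> X n \<omega> < 0) \<and>
              (\<forall>j<Suc N. t j \<le> (-1) ^ j * \<xi> (n + Suc N - j) \<omega>)}"
    unfolding p_def escape_prob_def t_def[symmetric] by (intro past) auto
  also have "\<dots> \<le> prob {\<omega> \<in> space M. V n \<omega> \<and> X n \<omega> < 0 \<and> \<not> V (n + Suc N) \<omega>}"
  proof (intro finite_measure_mono subsetI)
    fix \<omega>
    assume "\<omega> \<in> {\<omega> \<in> space M. (V n \<omega> \<and> X n \<omega> < 0) \<and>
              (\<forall>j<Suc N. t j \<le> (-1) ^ j * \<xi> (n + Suc N - j) \<omega>)}"
    then have \<omega>: "\<omega> \<in> space M" "V n \<omega>" "X n \<omega> < 0"
        and noise: "\<And>j. j < Suc N \<Longrightarrow> t j \<le> (-1) ^ j * \<xi> (n + Suc N - j) \<omega>"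
      by auto
    \<comment> \<open>Entry \<open>N\<close> has bound 0 and, \<open>N\<close> being even, positive
      sign; it concerns the noise at time \<open>Suc n\<close>.\<close>
    have "0 \<le> \<xi> (Suc n) \<omega>"
      using noise[of N] N by (simp add: t_def escape_noise_def)
    then show "\<omega> \<in> {\<omega> \<in> space M. V n \<omega> \<and> X n \<omega> < 0 \<and> \<not> V (n + Suc N) \<omega>}"
      using escape[of 1 \<omega>] neg_step[of \<omega>] \<omega> noise by auto
  qed measurable
  finally have neg: "prob {\<omega> \<in> space M. V n \<omega> \<and> X n \<omega> < 0} * p \<le> \<dots>" .
  have split: "prob {\<omega> \<in> space M. V n \<omega>}
      = prob {\<omega> \<in> space M. V n \<omega> \<and> 0 \<le> X n \<omega>} + prob {\<omega> \<in> space M. V n \<omega> \<and> X n \<omega> < 0}"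
    by (subst finite_measure_Union[symmetric]) (auto intro!: arg_cong[where f=prob])
  \<comment> \<open>Survival is decreasing in time: the mass alive at \<open>n\<close> either exits
    within the block, from one of the two sides, or survives to its end.\<close>
  have "prob {\<omega> \<in> space M. V n \<omega>}
      = prob {\<omega> \<in> space M. V n \<omega> \<and> 0 \<le> X n \<omega> \<and> \<not> V (n + Suc N) \<omega>}
      + prob {\<omega> \<in> space M. V n \<omega> \<and> X n \<omega> < 0 \<and> \<not> V (n + Suc N) \<omega>}
      + prob {\<omega> \<in> space M. V (n + Suc N) \<omega>}"
  proof -
    have "V (n + Suc N) \<omega> \<Longrightarrow> V n \<omega>" for \<omega> by (auto simp: V_def survives_def)
    then show ?thesis
      by (subst finite_measure_Union[symmetric], simp, simp, force)+
        (auto intro!: arg_cong[where f=prob])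
  qed
  moreover have "prob {\<omega> \<in> space M. V n \<omega>} * p
      = prob {\<omega> \<in> space M. V n \<omega> \<and> 0 \<le> X n \<omega>} * p + prob {\<omega> \<in> space M. V n \<omega> \<and> X n \<omega> < 0} * p"
    unfolding split by (rule distrib_right)
  ultimately have "prob {\<omega> \<in> space M. V (n + Suc N) \<omega>} \<le> (1 - p) * prob {\<omega> \<in> space M. V n \<omega>}"
    using pos neg by (simp add: left_diff_distrib mult.commute)
  then show ?thesis
    by (simp only: V_def p_def)
qed

section \<open>The expected exit time\<close>

text \<open>The decay gives \<open>p * u n \<le> u n - u (n + m)\<close>. Summing telescopes with
  stride \<open>m\<close> and leaves at most \<open>m\<close> terms, each at most 1.\<close>

lemma sum_le_of_block_decay:
  fixes u :: "nat \<Rightarrow> real"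
  assumes "\<And>n. 0 \<le> u n" "\<And>n. u n \<le> 1" "\<And>n. u (n + m) \<le> (1 - p) * u n" "0 < p"
  shows "(\<Sum>n<k. u n) \<le> real m / p"
proof -
  have "p * (\<Sum>n<k. u n) = (\<Sum>n<k. p * u n)" by (simp add: sum_distrib_left)
  also have "\<dots> \<le> (\<Sum>n<k. u n - u (n + m))"
    using assms(3) by (intro sum_mono) (simp add: algebra_simps)
  also have "\<dots> = (\<Sum>n<k. u n) - (\<Sum>n\<in>{m..<k+m}. u n)"
    using sum.shift_bounds_nat_ivl[of u 0 m k] by (simp add: sum_subtractf atLeast0LessThan)
  also have "\<dots> \<le> (\<Sum>n<m. u n)"
  proof -
    have "(\<Sum>n<k. u n) \<le> (\<Sum>n\<in>{..<m} \<union> {m..<k+m}. u n)"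
      using assms(1) by (intro sum_mono2) auto
    also have "\<dots> = (\<Sum>n<m. u n) + (\<Sum>n\<in>{m..<k+m}. u n)"
      by (intro sum.union_disjoint) auto
    finally show ?thesis by simp
  qed
  also have "\<dots> \<le> real m" using sum_bounded_above[of "{..<m}" u 1] assms(2) by simp
  finally show ?thesis using \<open>0 < p\<close> by (simp add: field_simps)
qed

text \<open>The expectation is the sum of the survival probabilities, whose partial sums are bounded
  by block decay.\<close>

lemma (in prob_space) expected_exit_time_le:
  assumes iid: "iid_std_normal M \<xi>" and f_meas: "f \<in> borel_measurable borel"
    and f: "skew_tent a b f" and ab: "0 < a" "0 < b"
    and N: "0 < N" "even N" and \<epsilon>: "0 < \<epsilon>"
  shows "expected_exit_time M f \<xi> \<epsilon> \<le> ennreal (real (Suc N) / escape_prob a b N \<epsilon>)"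
proof -
  have \<xi>_meas: "\<xi> i \<in> borel_measurable M" if "1 \<le> i" for i
    using iid that by (auto simp: iid_std_normal_def distributed_def)
  have meas: "Measurable.pred M (survives f \<xi> \<epsilon> n)" for n
    by (intro pred_survives f_meas \<xi>_meas) auto
  define u where "u n = prob {\<omega> \<in> space M. survives f \<xi> \<epsilon> n \<omega>}" for n
  have "expected_exit_time M f \<xi> \<epsilon> = (\<Sum>n. ennreal (u n))"
    unfolding expected_exit_time_def nn_integral_enat_function[OF measurable_exit_time[OF meas]]
    by (simp add: less_exit_time_iff emeasure_eq_measure u_def)
  also have "\<dots> \<le> ennreal (real (Suc N) / escape_prob a b N \<epsilon>)"
  proof (rule suminf_le_const[OF summableI])
    fix k
    have "(\<Sum>n<k. u n) \<le> real (Suc N) / escape_prob a b N \<epsilon>"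
      using survival_decay[OF assms]
      by (intro sum_le_of_block_decay escape_prob_pos) (auto simp: u_def)
    then show "(\<Sum>n<k. ennreal (u n)) \<le> ennreal (real (Suc N) / escape_prob a b N \<epsilon>)"
      by (subst sum_ennreal) (auto simp: u_def intro!: ennreal_leI)
  qed
  finally show ?thesis .
qed

section \<open>Logarithmic asymptotics\<close>

text \<open>The finite bound rules out the value infinity of \<open>ln_ext\<close>; at
  \<open>x = 0\<close> the left side is minus infinity.\<close>

lemma scaled_ln_ext_le:
  assumes "x \<le> ennreal C" "0 < C" "0 < c"
  shows "ereal c * ln_ext x \<le> ereal (c * ln C)"
proof (cases "x = 0")
  case False
  have "x \<noteq> \<infinity>" using assms by (auto simp: top_unique)
  then have "0 < enn2real x" "enn2real x \<le> C"
    using False assms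
    by (auto simp: enn2real_positive_iff top.not_eq_extremum zero_less_iff_neq_zero intro!: enn2real_leI)
  then show ?thesis
    using False \<open>x \<noteq> \<infinity>\<close> assms by (auto simp: ln_ext_def intro!: mult_left_mono)
qed (use assms in \<open>simp add: ln_ext_def\<close>)

lemma ln_std_normal_density: "ln (std_normal_density x) = - x\<^sup>2 / 2 - ln (sqrt (2 * pi))"
  by (simp add: std_normal_density_def ln_mult ln_div)

text \<open>Only the squares of the planned noises survive the scaling; the normalising constants,
  the factor \<open>Suc N\<close> and the preliminary step are of the order of \<epsilon>
  squared.\<close>

lemma escape_cost_tendsto:
  assumes ab: "0 < a" "0 < b" and N: "0 < N"
  shows "((\<lambda>\<epsilon>. \<epsilon>\<^sup>2 * ln (real (Suc N) / escape_prob a b N \<epsilon>)) \<longlongrightarrow> 1 / (2 * path_energy a b N)) (at_right 0)"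
proof -
  \<comment> \<open>By Cauchy-Schwarz this noise has the least sum of squares among those whose sum
    weighted by \<open>path_weight\<close> is 1; that least value is
    \<open>1 / path_energy a b N\<close>.\<close>
  define c where "c j = path_weight a b j / path_energy a b N" for j
  define L where "L = ln (sqrt (2 * pi))"
  define \<beta> where "\<beta> \<epsilon> = \<epsilon>\<^sup>2 * ln (real (Suc N)) + (\<Sum>j<N. (c j + \<epsilon>)\<^sup>2 / 2 + \<epsilon>\<^sup>2 * L) + \<epsilon>\<^sup>2 * (1 / 2 + L)" for \<epsilon>
  have "\<epsilon>\<^sup>2 * ln (real (Suc N) / escape_prob a b N \<epsilon>) = \<beta> \<epsilon>" if "0 < \<epsilon>" for \<epsilon>
  proof -
    have "\<epsilon>\<^sup>2 * ln (real (Suc N) / escape_prob a b N \<epsilon>)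
        = \<epsilon>\<^sup>2 * ln (real (Suc N)) - \<epsilon>\<^sup>2 * ln (escape_prob a b N \<epsilon>)"
      using escape_prob_pos[of a b N \<epsilon>] by (simp add: ln_div right_diff_distrib)
    also have "ln (escape_prob a b N \<epsilon>)
        = (\<Sum>j<Suc N. - (escape_noise a b N \<epsilon> j + 1)\<^sup>2 / 2 - L)"
      unfolding escape_prob_def
      by (subst ln_prod)
        (auto simp: ln_std_normal_density L_def normal_density_pos[THEN less_imp_neq, symmetric])
    also have "\<epsilon>\<^sup>2 * \<dots> = (\<Sum>j<N. - (c j + \<epsilon>)\<^sup>2 / 2 - \<epsilon>\<^sup>2 * L) - \<epsilon>\<^sup>2 * (1 / 2 + L)"
    proof -
      have "\<epsilon>\<^sup>2 * (- (escape_noise a b N \<epsilon> j + 1)\<^sup>2 / 2 - L) = - (c j + \<epsilon>)\<^sup>2 / 2 - \<epsilon>\<^sup>2 * L"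
        if "j < N" for j
      proof -
        have "(c j + \<epsilon>)\<^sup>2 = (\<epsilon> * (escape_noise a b N \<epsilon> j + 1))\<^sup>2"
          using that \<open>0 < \<epsilon>\<close> by (simp add: escape_noise_def c_def distrib_left)
        then show ?thesis by (simp add: power_mult_distrib right_diff_distrib)
      qed
      then show ?thesis
        by (simp add: sum_distrib_left distrib_left right_diff_distrib escape_noise_def[of _ _ _ _ N])
    qed
    finally show ?thesis
      by (simp add: \<beta>_def sum_subtractf sum_negf sum.distrib flip: sum_divide_distrib)
  qed
  then have ev: "eventually (\<lambda>\<epsilon>. \<beta> \<epsilon> = \<epsilon>\<^sup>2 * ln (real (Suc N) / escape_prob a b N \<epsilon>)) (at_right 0)"
    by (auto simp: eventually_at_right_field intro!: exI[of _ 1])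
  have "(\<beta> \<longlongrightarrow> 0\<^sup>2 * ln (real (Suc N)) + (\<Sum>j<N. (c j + 0)\<^sup>2 / 2 + 0\<^sup>2 * L) + 0\<^sup>2 * (1 / 2 + L)) (at_right 0)"
    unfolding \<beta>_def by (intro tendsto_intros) simp_all
  also have "0\<^sup>2 * ln (real (Suc N)) + (\<Sum>j<N. (c j + 0)\<^sup>2 / 2 + 0\<^sup>2 * L) + 0\<^sup>2 * (1 / 2 + L)
      = (\<Sum>j<N. (c j)\<^sup>2) / 2"
    by (simp add: sum_divide_distrib)
  also have "(\<Sum>j<N. (c j)\<^sup>2) = 1 / path_energy a b N"
    using path_energy_pos[OF ab N]
    by (simp add: c_def power_divide flip: sum_divide_distrib path_energy_def)
      (simp add: power2_eq_square)
  finally show ?thesis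
    by (simp add: tendsto_cong[OF ev] mult.commute)
qed

text \<open>The left side does not depend on \<open>N\<close>, so after \<epsilon> has gone to 0 the
  bound may be taken to its limit along even \<open>N\<close>.\<close>

lemma (in prob_space) Limsup_exit_time_le:
  assumes iid: "iid_std_normal M \<xi>" and f_meas: "f \<in> borel_measurable borel"
    and f: "skew_tent a b f" and ab: "0 < a" "a < 1" "0 < b" "b < 1"
  shows "Limsup (at_right 0) (\<lambda>\<epsilon>. ereal (\<epsilon>\<^sup>2) * ln_ext (expected_exit_time M f \<xi> \<epsilon>))
    \<le> ereal (1 / 2 * ((1 - (a * b)\<^sup>2) / (1 + b\<^sup>2)))" (is "?L \<le> _")
proof -
  have fin: "?L \<le> ereal (1 / (2 * path_energy a b N))" if N: "0 < N" "even N" for N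
  proof -
    have "?L \<le> Limsup (at_right 0) (\<lambda>\<epsilon>. ereal (\<epsilon>\<^sup>2 * ln (real (Suc N) / escape_prob a b N \<epsilon>)))"
    proof (rule Limsup_mono)
      have "ereal (\<epsilon>\<^sup>2) * ln_ext (expected_exit_time M f \<xi> \<epsilon>)
          \<le> ereal (\<epsilon>\<^sup>2 * ln (real (Suc N) / escape_prob a b N \<epsilon>))" if "0 < \<epsilon>" for \<epsilon>
        using that escape_prob_pos[of a b N \<epsilon>]
        by (intro scaled_ln_ext_le expected_exit_time_le[OF iid f_meas f ab(1,3) N]) auto
      then show "eventually (\<lambda>\<epsilon>. ereal (\<epsilon>\<^sup>2) * ln_ext (expected_exit_time M f \<xi> \<epsilon>)
          \<le> ereal (\<epsilon>\<^sup>2 * ln (real (Suc N) / escape_prob a b N \<epsilon>))) (at_right 0)"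
        by (auto simp: eventually_at_right_field intro!: exI[of _ 1])
    qed
    also have "\<dots> = ereal (1 / (2 * path_energy a b N))"
      using escape_cost_tendsto[OF ab(1,3) N(1)]
      by (intro lim_imp_Limsup) auto
    finally show ?thesis .
  qed
  have q: "0 < a * b" "a * b < 1"
    using ab mult_strict_mono[of a 1 b 1] by auto
  define e where "e = 1 / 2 * ((1 - (a * b)\<^sup>2) / (1 + b\<^sup>2))"
  \<comment> \<open>With \<open>N = 2 * Suc k\<close> the closed form of the energy leaves
    \<open>e\<close> divided by 1 minus a vanishing term.\<close>
  have le: "?L \<le> ereal (e / (1 - (a * b) ^ (2 * Suc k)))" for k
  proof -
    have "(a * b) ^ (2 * Suc k) < 1" "(a * b)\<^sup>2 < 1"
      using q by (intro power_less_one_iff[THEN iffD2]; simp)+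
    moreover have "0 < 1 + b\<^sup>2" by (simp add: add_pos_nonneg)
    ultimately have "1 / (2 * path_energy a b (2 * Suc k)) = e / (1 - (a * b) ^ (2 * Suc k))"
      using path_energy_even[of a b "Suc k"] path_energy_pos[of a b "2 * Suc k"] ab
      unfolding e_def by (simp add: divide_simps del: power_Suc mult_Suc_right) (simp add: algebra_simps)
    then show ?thesis using fin[of "2 * Suc k"] by simp
  qed
  have lim: "(\<lambda>k. ereal (e / (1 - (a * b) ^ (2 * Suc k)))) \<longlonglongrightarrow> ereal (e / (1 - 0))"
  proof -
    have "(\<lambda>k. ((a * b)\<^sup>2) ^ Suc k) \<longlonglongrightarrow> 0"
      using q by (intro LIMSEQ_Suc LIMSEQ_power_zero) (simp add: power_less_one_iff abs_square_less_1)
    then have "(\<lambda>k. (a * b) ^ (2 * Suc k)) \<longlonglongrightarrow> 0"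
      by (simp only: power_mult)
    then show ?thesis
      by (intro tendsto_intros) simp_all
  qed
  have "?L \<le> ereal (e / (1 - 0))"
    using le by (intro LIMSEQ_le_const[OF lim]) blast
  then show ?thesis by (simp add: e_def)
qed

section \<open>Reflection and the minimum of the two bounds\<close>

text \<open>Negating both space and noise preserves distances from 0, and with them the exit
  time.\<close>

lemma noisy_orbit_reflect:
  "noisy_orbit (\<lambda>x. - f (- x)) (\<lambda>i \<omega>. - \<xi> i \<omega>) \<epsilon> n \<omega> = - noisy_orbit f \<xi> \<epsilon> n \<omega>"
  by (induction n) auto

lemma (in prob_space) iid_std_normal_uminus:
  assumes "iid_std_normal M \<xi>"
  shows "iid_std_normal M (\<lambda>i \<omega>. - \<xi> i \<omega>)"
  unfolding iid_std_normal_def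
proof (intro conjI allI impI)
  show "indep_vars (\<lambda>_. borel) (\<lambda>i \<omega>. - \<xi> i \<omega>) {1..}"
    using assms unfolding iid_std_normal_def
    by (intro indep_vars_compose2[where Y="\<lambda>_. uminus" and M'="\<lambda>_. borel"]) auto
  fix n :: nat assume "1 \<le> n"
  then show "distributed M lborel (\<lambda>\<omega>. - \<xi> n \<omega>) std_normal_density"
    using assms normal_density_affine[of "\<xi> n" 0 1 "-1" 0] by (simp add: iid_std_normal_def)
qed

theorem mainTheorem7:
  fixes M :: "'a measure"
    and \<xi> :: "nat \<Rightarrow> 'a \<Rightarrow> real"
    and f :: "real \<Rightarrow> real"
    and a b :: real
  assumes "prob_space M"
    and "iid_std_normal M \<xi>"
    and "0 < a" and "a < 1"
    and "0 < b" and "b < 1"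
    and "continuous_on UNIV f"
    and "\<And>x. -1 \<le> x \<Longrightarrow> x < 0 \<Longrightarrow> f x = - b * x"
    and "\<And>x. 0 \<le> x \<Longrightarrow> x \<le> 1 \<Longrightarrow> f x = - a * x"
  shows "Limsup (at_right 0) (\<lambda>\<epsilon>. ereal (\<epsilon>\<^sup>2) * ln_ext (expected_exit_time M f \<xi> \<epsilon>))
    \<le> ereal (1 / 2 * min ((1 - (a * b)\<^sup>2) / (1 + a\<^sup>2)) ((1 - (a * b)\<^sup>2) / (1 + b\<^sup>2)))"
proof -
  interpret prob_space M by fact
  have f_meas: "f \<in> borel_measurable borel"
    by (rule borel_measurable_continuous_onI) fact
  have f: "skew_tent a b f"
    using assms by (auto simp: skew_tent_def)
  define g where "g x = - f (- x)" for x
  have g_meas: "g \<in> borel_measurable borel"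
    using f_meas unfolding g_def[abs_def] by measurable
  \<comment> \<open>The point 0 changes branch under reflection, but both branches vanish
    there.\<close>
  have "g x = - b * x" if "0 \<le> x" "x \<le> 1" for x
    using assms(8)[of "- x"] assms(9)[of 0] that by (cases "x = 0") (auto simp: g_def)
  moreover have "g x = - a * x" if "-1 \<le> x" "x < 0" for x
    using assms(9)[of "- x"] that by (auto simp: g_def)
  ultimately have g: "skew_tent b a g"
    by (auto simp: skew_tent_def)
  have "expected_exit_time M g (\<lambda>i \<omega>. - \<xi> i \<omega>) \<epsilon> = expected_exit_time M f \<xi> \<epsilon>" for \<epsilon>
    by (simp add: expected_exit_time_def exit_time_def g_def[abs_def] noisy_orbit_reflect)
  \<comment> \<open>The original map gives the term with \<open>1 + b\<^sup>2\<close>;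
    \<open>g\<close>, with slopes swapped, gives the one with \<open>1 + a\<^sup>2\<close>.\<close>
  then show ?thesis
    using Limsup_exit_time_le[OF assms(2) f_meas f assms(3-6)]
      Limsup_exit_time_le[OF iid_std_normal_uminus[OF assms(2)] g_meas g assms(5,6,3,4)]
    by (simp add: min_def mult.commute)
qed

end
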